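(* Let $\alpha(s)$ be a unit speed curve in Euclidean $4$-space $\mathbb{E}^4$ with parallel transport vector fields $T, M_1, M_2, M_3$ and curvature functions $k_1, k_2, k_3$ according to this frame. Then $\alpha$ is a normal curve if and only if $\alpha$ is a spherical curve.
   Context: $\mathbb{E}^4$ is $\mathbb{R}^4$ with the standard inner product $\langle\cdot,\cdot\rangle$; primes denote derivatives with respect to the arclength parameter $s$, and curves are sufficiently differentiable. A vector field along a unit speed curve $\alpha$ that is perpendicular to $T=\alpha'$ is called relatively parallel if its derivative is tangential (a multiple of $T$) along $\alpha$. A parallel transport frame of $\alpha$ is an orthonormal frame $\{T, M_1, M_2, M_3\}$ along $\alpha$ with $T=\alpha'$ and $M_1, M_2, M_3$ relatively parallel; its curvatures are $k_i = \langle T', M_i\rangle$, so that $T' = k_1M_1+k_2M_2+k_3M_3$ and $M_i' = -k_iT$ for $i=1,2,3$. A normal curve is a curve whose position vector always lies in its normal space $T^\perp = \{X\in\mathbb{E}^4 \mid \langle X, T\rangle = 0\}$, i.e. $\alpha(s) = \lambda(s)M_1(s) + \mu(s)M_2(s) + \upsilon(s)M_3(s)$ for some differentiable functions $\lambda,\mu,\upsilon$. A spherical curve is a curve lying on a sphere, i.e. $\langle \alpha - P, \alpha - P\rangle = r^2$ for some fixed point $P\in\mathbb{E}^4$ and some constant $r>0$.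
   Formalization: As literally stated, spherical does not imply normal (a unit circle centred away from the origin is spherical but not normal), so "normal curve" is read as normal after a translation: for some fixed point P, the vector α(s) − P always lies in the normal space of α. *)

theory Defs
  imports "HOL-Analysis.Analysis"
begin

text \<open>
  Curves are functions \<^typ>\<open>real \<Rightarrow> real ^ 4\<close> considered on an interval \<open>I\<close> with nonempty interior
  (open, closed, half-open or unbounded).  All derivatives are taken within \<open>I\<close>, hence are
  one-sided at end points that belong to \<open>I\<close>.
\<close>

definition unit_speed :: "real set \<Rightarrow> (real \<Rightarrow> real ^ 4) \<Rightarrow> bool" where
  "unit_speed I \<alpha> \<longleftrightarrow>
     (\<forall>s\<in>I. \<alpha> differentiable (at s within I) \<and> norm (vector_derivative \<alpha> (at s within I)) = 1)"

definition relatively_parallel ::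
    "real set \<Rightarrow> (real \<Rightarrow> real ^ 4) \<Rightarrow> (real \<Rightarrow> real ^ 4) \<Rightarrow> bool" where
  "relatively_parallel I T M \<longleftrightarrow>
     (\<forall>s\<in>I. M s \<bullet> T s = 0 \<and> (\<exists>c. (M has_vector_derivative c *\<^sub>R T s) (at s within I)))"

definition orthonormal_frame ::
    "real set \<Rightarrow> (real \<Rightarrow> real ^ 4) \<Rightarrow> (real \<Rightarrow> real ^ 4) \<Rightarrow> (real \<Rightarrow> real ^ 4) \<Rightarrow> (real \<Rightarrow> real ^ 4) \<Rightarrow> bool"
  where
  "orthonormal_frame I E0 E1 E2 E3 \<longleftrightarrow>
     (\<forall>s\<in>I. norm (E0 s) = 1 \<and> norm (E1 s) = 1 \<and> norm (E2 s) = 1 \<and> norm (E3 s) = 1 \<and>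
        E0 s \<bullet> E1 s = 0 \<and> E0 s \<bullet> E2 s = 0 \<and> E0 s \<bullet> E3 s = 0 \<and>
        E1 s \<bullet> E2 s = 0 \<and> E1 s \<bullet> E3 s = 0 \<and> E2 s \<bullet> E3 s = 0)"

definition parallel_transport_frame ::
    "real set \<Rightarrow> (real \<Rightarrow> real ^ 4) \<Rightarrow>
     (real \<Rightarrow> real ^ 4) \<Rightarrow> (real \<Rightarrow> real ^ 4) \<Rightarrow> (real \<Rightarrow> real ^ 4) \<Rightarrow> (real \<Rightarrow> real ^ 4) \<Rightarrow> bool"
  where
  "parallel_transport_frame I \<alpha> T M1 M2 M3 \<longleftrightarrow>
     (\<forall>s\<in>I. (\<alpha> has_vector_derivative T s) (at s within I)) \<and>
     (\<forall>s\<in>I. T differentiable (at s within I)) \<and>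
     orthonormal_frame I T M1 M2 M3 \<and>
     relatively_parallel I T M1 \<and> relatively_parallel I T M2 \<and> relatively_parallel I T M3"

definition frame_curvature ::
    "real set \<Rightarrow> (real \<Rightarrow> real ^ 4) \<Rightarrow> (real \<Rightarrow> real ^ 4) \<Rightarrow> real \<Rightarrow> real" where
  "frame_curvature I T M s = vector_derivative T (at s within I) \<bullet> M s"

definition normal_space :: "real ^ 4 \<Rightarrow> (real ^ 4) set" where
  "normal_space t = {X. X \<bullet> t = 0}"

text \<open>
  Unlike \<open>spherical_curve\<close> below, \<open>normal_curve\<close> is not translation invariant: it refers to the
  position vector from the origin.  The position vector from a point \<open>P\<close> is that of the
  translated curve \<open>\<lambda>s. \<alpha> s - P\<close>.  For instance, a unit circle is spherical,
  but it is normal with respect to \<open>P\<close> only if \<open>P\<close> projects to its centre.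
\<close>

definition normal_curve :: "real set \<Rightarrow> (real \<Rightarrow> real ^ 4) \<Rightarrow> bool" where
  "normal_curve I \<alpha> \<longleftrightarrow> (\<forall>s\<in>I. \<alpha> s \<in> normal_space (vector_derivative \<alpha> (at s within I)))"

definition spherical_curve :: "real set \<Rightarrow> (real \<Rightarrow> real ^ 4) \<Rightarrow> bool" where
  "spherical_curve I \<alpha> \<longleftrightarrow> (\<exists>P r. r > 0 \<and> (\<forall>s\<in>I. (\<alpha> s - P) \<bullet> (\<alpha> s - P) = r\<^sup>2))"

lemma at_within_interval_nontrivial:
  fixes I :: "real set"
  assumes "is_interval I" "interior I \<noteq> {}" "s \<in> I"
  shows "at s within I \<noteq> bot"
proof -
  have "connected I" using assms(1) by (simp add: is_interval_connected)
  moreover have "\<And>x. I \<noteq> {x}" using assms(2) by auto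
  ultimately have "s islimpt I" using assms(3) by (simp add: connected_imp_perfect)
  thus ?thesis by (simp add: trivial_limit_within)
qed

lemma orthonormal_frame_expansion:
  assumes "orthonormal_frame I E0 E1 E2 E3" "s \<in> I"
  shows "x = (x \<bullet> E0 s) *\<^sub>R E0 s + (x \<bullet> E1 s) *\<^sub>R E1 s + (x \<bullet> E2 s) *\<^sub>R E2 s + (x \<bullet> E3 s) *\<^sub>R E3 s"
proof -
  let ?B = "{E0 s, E1 s, E2 s, E3 s}"
  note o = assms(1)[unfolded orthonormal_frame_def, rule_format, OF assms(2)]
  have n: "E0 s \<bullet> E0 s = 1" "E1 s \<bullet> E1 s = 1" "E2 s \<bullet> E2 s = 1" "E3 s \<bullet> E3 s = 1"
    using o by (simp_all add: norm_eq_1)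
  have d: "E0 s \<noteq> E1 s" "E0 s \<noteq> E2 s" "E0 s \<noteq> E3 s" "E1 s \<noteq> E2 s" "E1 s \<noteq> E3 s" "E2 s \<noteq> E3 s"
    using o n by auto
  have c: "E1 s \<bullet> E0 s = 0" "E2 s \<bullet> E0 s = 0" "E3 s \<bullet> E0 s = 0"
      "E2 s \<bullet> E1 s = 0" "E3 s \<bullet> E1 s = 0" "E3 s \<bullet> E2 s = 0"
    using o by (metis inner_commute)+
  have orth: "pairwise orthogonal ?B"
    using o c by (auto simp: pairwise_insert orthogonal_def)
  have "independent ?B"
    using n by (intro pairwise_orthogonal_independent orth) auto
  moreover have "card ?B = 4" using d by simp
  ultimately have sp: "UNIV \<subseteq> span ?B"
    by (intro card_ge_dim_independent) (auto simp: dim_UNIV)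
  define y where "y = x - ((x \<bullet> E0 s) *\<^sub>R E0 s + (x \<bullet> E1 s) *\<^sub>R E1 s
    + (x \<bullet> E2 s) *\<^sub>R E2 s + (x \<bullet> E3 s) *\<^sub>R E3 s)"
  have "y \<bullet> E0 s = 0" "y \<bullet> E1 s = 0" "y \<bullet> E2 s = 0" "y \<bullet> E3 s = 0"
    using o n c by (simp_all add: y_def inner_diff_left inner_add_left)
  hence "orthogonal y b" if "b \<in> ?B" for b
    using that by (auto simp: orthogonal_def)
  hence "orthogonal y y"
    by (intro orthogonal_to_span[of y ?B]) (use sp in auto)
  hence "y = 0" by (simp add: orthogonal_self)
  thus ?thesis unfolding y_def by (rule eq_iff_diff_eq_0[THEN iffD2])
qed

text \<open>
  With respect to a parallel transport frame, a normal curve is one whose position vector has a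
  tangent-free expansion \<open>\<lambda> M1 + \<mu> M2 + \<upsilon> M3\<close> with differentiable coefficients.
\<close>

lemma normal_curve_iff_expansion:
  assumes I: "is_interval I" "interior I \<noteq> {}"
    and fr: "parallel_transport_frame I \<alpha> T M1 M2 M3"
  shows "normal_curve I \<alpha> \<longleftrightarrow>
    (\<exists>l m u. l differentiable_on I \<and> m differentiable_on I \<and> u differentiable_on I \<and>
       (\<forall>s\<in>I. \<alpha> s = l s *\<^sub>R M1 s + m s *\<^sub>R M2 s + u s *\<^sub>R M3 s))"
proof -
  have dT: "(\<alpha> has_vector_derivative T s) (at s within I)" if "s \<in> I" for s
    using fr that by (simp add: parallel_transport_frame_def)
  have vd: "vector_derivative \<alpha> (at s within I) = T s" if "s \<in> I" for s
    using at_within_interval_nontrivial[OF I that] dT[OF that] by (rule vector_derivative_within)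
  have nc: "normal_curve I \<alpha> \<longleftrightarrow> (\<forall>s\<in>I. \<alpha> s \<bullet> T s = 0)"
    by (simp add: normal_curve_def normal_space_def vd)
  have on: "orthonormal_frame I T M1 M2 M3"
    using fr by (simp add: parallel_transport_frame_def)
  have ad: "\<alpha> differentiable_on I"
    using dT by (auto simp: differentiable_on_def has_vector_derivative_def differentiable_def)
  have Md: "M1 differentiable_on I" "M2 differentiable_on I" "M3 differentiable_on I"
    using fr unfolding parallel_transport_frame_def relatively_parallel_def differentiable_on_def
    by (meson differentiableI_vector)+
  show ?thesis
  proof
    assume "normal_curve I \<alpha>"
    hence z: "\<forall>s\<in>I. \<alpha> s \<bullet> T s = 0" using nc by simp
    have "\<alpha> s = (\<alpha> s \<bullet> M1 s) *\<^sub>R M1 s + (\<alpha> s \<bullet> M2 s) *\<^sub>R M2 s + (\<alpha> s \<bullet> M3 s) *\<^sub>R M3 s"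
      if "s \<in> I" for s
      using orthonormal_frame_expansion[OF on that, of "\<alpha> s"] z that by simp
    moreover have "(\<lambda>s. \<alpha> s \<bullet> M1 s) differentiable_on I" "(\<lambda>s. \<alpha> s \<bullet> M2 s) differentiable_on I"
        "(\<lambda>s. \<alpha> s \<bullet> M3 s) differentiable_on I"
      using ad Md by (auto simp: differentiable_on_def intro: differentiable_inner)
    ultimately show "\<exists>l m u. l differentiable_on I \<and> m differentiable_on I \<and> u differentiable_on I \<and>
       (\<forall>s\<in>I. \<alpha> s = l s *\<^sub>R M1 s + m s *\<^sub>R M2 s + u s *\<^sub>R M3 s)" by blast
  next
    assume "\<exists>l m u. l differentiable_on I \<and> m differentiable_on I \<and> u differentiable_on I \<and>
       (\<forall>s\<in>I. \<alpha> s = l s *\<^sub>R M1 s + m s *\<^sub>R M2 s + u s *\<^sub>R M3 s)"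
    then obtain l m u where "\<forall>s\<in>I. \<alpha> s = l s *\<^sub>R M1 s + m s *\<^sub>R M2 s + u s *\<^sub>R M3 s"
      by blast
    moreover have "M1 s \<bullet> T s = 0" "M2 s \<bullet> T s = 0" "M3 s \<bullet> T s = 0" if "s \<in> I" for s
      using fr that by (simp_all add: parallel_transport_frame_def relatively_parallel_def)
    ultimately show "normal_curve I \<alpha>"
      by (simp add: nc inner_add_left)
  qed
qed

end

theory Submission
  imports Defs
begin

text \<open>
  The derivative of \<open>\<lambda>s. (\<alpha> s - P) \<bullet> (\<alpha> s - P)\<close> is \<open>2 * ((\<alpha> s - P) \<bullet> T s)\<close>, so
  \<open>\<alpha>\<close> is normal with respect to \<open>P\<close> iff its squared distance from \<open>P\<close> is constant. The constant
  cannot be zero, because a curve with unit tangent is not constant.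
\<close>

lemma has_real_derivative_inner_self:
  fixes f :: "real \<Rightarrow> 'a::real_inner"
  assumes "(f has_vector_derivative f') (at s within I)"
  shows "((\<lambda>s. f s \<bullet> f s) has_real_derivative 2 * (f s \<bullet> f')) (at s within I)"
  using bounded_bilinear.has_vector_derivative[OF bounded_bilinear_inner assms assms]
  by (simp add: has_real_derivative_iff_has_vector_derivative inner_commute)

text \<open>Both sides say that the derivative \<open>2 * (f s \<bullet> f' s)\<close> of the
  squared norm vanishes on \<open>I\<close>. From left to right this rests on uniqueness of
  derivatives within \<open>I\<close>, from right to left on convexity of \<open>I\<close>.\<close>

lemma inner_self_constant_iff_orthogonal_derivative:
  fixes f :: "real \<Rightarrow> 'a::real_inner"
  assumes I: "is_interval I" "interior I \<noteq> {}"
    and f: "\<And>s. s \<in> I \<Longrightarrow> (f has_vector_derivative f' s) (at s within I)"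
  shows "(\<exists>c. \<forall>s\<in>I. f s \<bullet> f s = c) \<longleftrightarrow> (\<forall>s\<in>I. f s \<bullet> f' s = 0)"
proof
  assume "\<exists>c. \<forall>s\<in>I. f s \<bullet> f s = c"
  then obtain c where c: "\<And>s. s \<in> I \<Longrightarrow> f s \<bullet> f s = c" by blast
  show "\<forall>s\<in>I. f s \<bullet> f' s = 0"
  proof
    fix s assume s: "s \<in> I"
    have "((\<lambda>_. c) has_real_derivative 2 * (f s \<bullet> f' s)) (at s within I)"
      \<comment> \<open>The squared norm agrees with \<open>c\<close> on all of \<open>I\<close>, so
        any positive radius would do; \<open>zero_less_one\<close> picks 1.\<close>
      using has_field_derivative_transform_within
        [OF has_real_derivative_inner_self[OF f[OF s]] zero_less_one s] c by auto
    hence "((\<lambda>_. c) has_vector_derivative 2 * (f s \<bullet> f' s)) (at s within I)"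
      by (simp add: has_real_derivative_iff_has_vector_derivative)
    hence "2 * (f s \<bullet> f' s) = 0"
      \<comment> \<open>No point of \<open>I\<close> is isolated, so even a one-sided derivative at
        an end point is unique.\<close>
      using vector_derivative_unique_within[OF at_within_interval_nontrivial[OF I s]]
        has_vector_derivative_const by blast
    thus "f s \<bullet> f' s = 0" by simp
  qed
next
  assume "\<forall>s\<in>I. f s \<bullet> f' s = 0"
  hence "((\<lambda>s. f s \<bullet> f s) has_real_derivative 0) (at s within I)" if "s \<in> I" for s
    using has_real_derivative_inner_self[OF f[OF that]] that by simp
  thus "\<exists>c. \<forall>s\<in>I. f s \<bullet> f s = c"
    using has_field_derivative_zero_constant[OF is_interval_convex[OF I(1)]] by blast
qed

text \<open>A constant has derivative 0, and derivatives within \<open>I\<close> are unique. This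
  serves to exclude a sphere of radius zero.\<close>

lemma not_constant_on_if_vector_derivative_nonzero:
  assumes I: "is_interval I" "interior I \<noteq> {}" and s: "s \<in> I"
    and f: "(f has_vector_derivative f') (at s within I)" "f' \<noteq> 0"
  shows "\<not> (\<forall>t\<in>I. f t = c)"
proof
  assume "\<forall>t\<in>I. f t = c"
  hence "((\<lambda>_. c) has_vector_derivative f') (at s within I)"
    using has_vector_derivative_transform[OF s _ f(1)] by simp
  hence "f' = 0"
    using vector_derivative_unique_within[OF at_within_interval_nontrivial[OF I s]]
      has_vector_derivative_const by blast
  thus False using f(2) by simp
qed

lemma normal_curve_iff_inner_self_constant:
  assumes I: "is_interval I" "interior I \<noteq> {}"
    and d: "\<And>s. s \<in> I \<Longrightarrow> (\<beta> has_vector_derivative T s) (at s within I)"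
  shows "normal_curve I \<beta> \<longleftrightarrow> (\<exists>c. \<forall>s\<in>I. \<beta> s \<bullet> \<beta> s = c)"
proof -
  have "vector_derivative \<beta> (at s within I) = T s" if "s \<in> I" for s
    using at_within_interval_nontrivial[OF I that] d[OF that] by (rule vector_derivative_within)
  thus ?thesis
    by (simp add: inner_self_constant_iff_orthogonal_derivative[OF I d]
        normal_curve_def normal_space_def)
qed

theorem theorem3:
  fixes I :: "real set" and \<alpha> T M1 M2 M3 :: "real \<Rightarrow> real ^ 4" and k1 k2 k3 :: "real \<Rightarrow> real"
  assumes "is_interval I" and "interior I \<noteq> {}"
    and "unit_speed I \<alpha>"
    and "parallel_transport_frame I \<alpha> T M1 M2 M3"
    and "\<forall>s\<in>I. k1 s = frame_curvature I T M1 s"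
    and "\<forall>s\<in>I. k2 s = frame_curvature I T M2 s"
    and "\<forall>s\<in>I. k3 s = frame_curvature I T M3 s"
  shows "(\<exists>P. normal_curve I (\<lambda>s. \<alpha> s - P)) \<longleftrightarrow> spherical_curve I \<alpha>"
proof -
  note I = assms(1,2)
  \<comment> \<open>Translation leaves the tangent unchanged, so the same \<open>T\<close> serves
    for every \<open>P\<close>.\<close>
  have d: "((\<lambda>s. \<alpha> s - P) has_vector_derivative T s) (at s within I)" if "s \<in> I" for s P
    using assms(4) that by (auto simp: parallel_transport_frame_def intro: derivative_eq_intros)
  have normal_iff: "normal_curve I (\<lambda>s. \<alpha> s - P) \<longleftrightarrow>
      (\<exists>c. \<forall>s\<in>I. (\<alpha> s - P) \<bullet> (\<alpha> s - P) = c)" for P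
    by (rule normal_curve_iff_inner_self_constant[OF I d])
  show ?thesis
  proof
    assume "\<exists>P. normal_curve I (\<lambda>s. \<alpha> s - P)"
    then obtain P c where c: "\<forall>s\<in>I. (\<alpha> s - P) \<bullet> (\<alpha> s - P) = c"
      using normal_iff by blast
    obtain s where s: "s \<in> I" using I(2) interior_subset by blast
    have "T s \<noteq> 0"
      using assms(4) s by (auto simp: parallel_transport_frame_def orthonormal_frame_def)
    hence "\<not> (\<forall>t\<in>I. \<alpha> t - P = 0)"
      by (rule not_constant_on_if_vector_derivative_nonzero[OF I s d[OF s]])
    \<comment> \<open>As a squared distance \<open>c\<close> is nonnegative, and
      \<open>c = 0\<close> would put the whole curve at \<open>P\<close>.\<close>
    hence "c > 0" using c by (metis inner_gt_zero_iff)
    hence "sqrt c > 0" "\<forall>s\<in>I. (\<alpha> s - P) \<bullet> (\<alpha> s - P) = (sqrt c)\<^sup>2"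
      using c by simp_all
    thus "spherical_curve I \<alpha>" unfolding spherical_curve_def by blast
  next
    assume "spherical_curve I \<alpha>"
    \<comment> \<open>The centre of the sphere is the required \<open>P\<close>, with constant
      \<open>r\<^sup>2\<close>.\<close>
    thus "\<exists>P. normal_curve I (\<lambda>s. \<alpha> s - P)"
      unfolding spherical_curve_def normal_iff by blast
  qed
qed

end
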